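(* Let $M$ be an $n$-dimensional Hadamard manifold, let $p\in M$, let $f:M\to\mathbb{R}\cup\{+\infty\}$ be proper and let $x\in\operatorname{dom}f$. Then $$\mathcal{N}^p(x)\le f(x)-f_p^{**}(x).$$ If, in addition, $\partial B^p f(x)\neq\varnothing$, then, for every $y\in\mathcal{Y}_p^f(x)$, $$\mathcal{N}^p(x)\le f(x)-f_p^{**}(x)\le H_p(x,y)-H_p(y,x)\le-\mathcal{N}^p(y).$$ Consequently, $$f(x)-f_p^{**}(x)\le\inf_{y\in\mathcal{Y}_p^f(x)}\{-\mathcal{N}^p(y)\}.$$
   Context: A Hadamard manifold is a complete, simply connected Riemannian manifold of nonpositive sectional curvature; $d$ is its Riemannian distance and $\exp$ its exponential map (each $\exp_p$ is a diffeomorphism). A function $f:M\to\mathbb{R}\cup\{+\infty\}$ is proper if $\operatorname{dom}f=\{x: f(x)<+\infty\}\neq\varnothing$. For $q\in M$ and a unit vector $u\in T_qM$, $\gamma_{(q,u)}(t)=\exp_q(tu)$, $t\ge 0$, is the unit-speed geodesic ray from $q$ in direction $u$, and $B_u^q(x)=\lim_{t\to+\infty}\bigl(d(x,\gamma_{(q,u)}(t))-t\bigr)$ is the Busemann function. For a nonzero $u\in T_qM$, $B_u^q:=B_{u/\|u\|}^q$. Two unit-speed rays $\gamma,\sigma$ are asymptotic if $t\mapsto d(\gamma(t),\sigma(t))$ is bounded on $[0,\infty)$; for each ray and each point $q$ there is exactly one ray from $q$ asymptotic to it. Busemann coupling with base point $p$: $H_p:M\times M\to\mathbb{R}$, $H_p(z,y)=d(p,z)\,B^p_{-\exp_p^{-1}z}(y)$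 if $z\ne p$, and $H_p(p,y)=0$. Conjugate and biconjugate (extended-real valued): $f_p^*(y)=\sup_{z\in M}\{H_p(z,y)-f(z)\}$ and $f_p^{**}(x)=\sup_{y\in M}\{H_p(y,x)-f_p^*(y)\}$. Nonlinearity measure: $\mathcal{N}^p(y):=\inf_{z\in M}\{H_p(y,z)-H_p(z,y)\}\in[-\infty,0]$, $y\in M$. For $x\in M$ and $v\in T_xM\setminus\{0\}$, $\eta_{p,x}(v)\in T_pM$ is the unique unit vector such that $\gamma_{(p,\eta_{p,x}(v))}$ and $\gamma_{(x,-v/\|v\|)}$ are asymptotic; $Y_p(x,v):=\exp_p(-\|v\|\,\eta_{p,x}(v))$ for $v\neq 0$ and $Y_p(x,0):=p$. $B^p$-subdifferential: for $x\in\operatorname{dom}f$, $\partial B^p f(x)$ is the set of all $v\in T_xM$ such that $f(z)\ge f(x)+H_p(z,Y_p(x,v))-H_p(x,Y_p(x,v))$ for all $z\in M$. The associated set of dual points is $\mathcal{Y}_p^f(x):=\{Y_p(x,v): v\in\partial B^p f(x)\}$; by convention $\inf\varnothing=+\infty$. *)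

theory Defs
  imports "HOL-Analysis.Analysis"
begin

section \<open>Smooth functions on open subsets of Euclidean space\<close>

text \<open>On an open set, being \<open>k\<close> times continuously (Frechet) differentiable.\<close>

fun ck_on :: "nat \<Rightarrow> 'a::euclidean_space set \<Rightarrow> ('a \<Rightarrow> 'b::real_normed_vector) \<Rightarrow> bool" where
  "ck_on 0 S f \<longleftrightarrow> continuous_on S f"
| "ck_on (Suc k) S f \<longleftrightarrow>
     (\<forall>x\<in>S. f differentiable (at x)) \<and> (\<forall>v. ck_on k S (\<lambda>x. frechet_derivative f (at x) v))"

definition smooth_on :: "'a::euclidean_space set \<Rightarrow> ('a \<Rightarrow> 'b::real_normed_vector) \<Rightarrow> bool" where
  "smooth_on S f \<longleftrightarrow> (\<forall>k. ck_on k S f)"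

section \<open>Riemannian manifolds\<close>

text \<open>
  The underlying set of a manifold is the whole of a type \<open>'m\<close>, whose topology is Hausdorff and
  second countable; its dimension is \<open>CARD('n)\<close>. A chart is a pair of its domain and its
  coordinate map. A tangent vector at \<open>p\<close> is represented by the family of its coordinate vectors
  in all charts of the atlas around \<open>p\<close>, related by the usual transformation law; to make the
  representation unique, the family is 0 at all other charts. Vector space operations are pointwise.
\<close>

type_synonym ('m, 'n) chart = "'m set \<times> ('m \<Rightarrow> real^'n)"
type_synonym ('m, 'n) tvec = "('m, 'n) chart \<Rightarrow> real^'n"

record ('m, 'n::finite) riemannian =
  atlas :: "('m, 'n) chart set"
  metric_at :: "'m \<Rightarrow> ('m, 'n) tvec \<Rightarrow> ('m, 'n) tvec \<Rightarrow> real"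

abbreviation chart_dom :: "('m, 'n) chart \<Rightarrow> 'm set" where
  "chart_dom c \<equiv> fst c"

abbreviation chart_map :: "('m, 'n) chart \<Rightarrow> 'm \<Rightarrow> real^'n" where
  "chart_map c \<equiv> snd c"

definition chart_inv :: "('m, 'n) chart \<Rightarrow> real^'n \<Rightarrow> 'm" where
  "chart_inv c = inv_into (chart_dom c) (chart_map c)"

definition is_chart :: "('m::topological_space, 'n::finite) chart \<Rightarrow> bool" where
  "is_chart c \<longleftrightarrow> open (chart_dom c) \<and> open (chart_map c ` chart_dom c) \<and>
     homeomorphism (chart_dom c) (chart_map c ` chart_dom c) (chart_map c) (chart_inv c)"

definition transition :: "('m, 'n) chart \<Rightarrow> ('m, 'n) chart \<Rightarrow> real^'n \<Rightarrow> real^'n" where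
  "transition c c' = chart_map c' \<circ> chart_inv c"

definition smooth_atlas :: "('m::topological_space, 'n::finite) chart set \<Rightarrow> bool" where
  "smooth_atlas A \<longleftrightarrow> (\<forall>c\<in>A. is_chart c) \<and> (\<Union>c\<in>A. chart_dom c) = UNIV \<and>
     (\<forall>c\<in>A. \<forall>c'\<in>A. smooth_on (chart_map c ` (chart_dom c \<inter> chart_dom c')) (transition c c'))"

definition charts_at :: "('m, 'n::finite) riemannian \<Rightarrow> 'm \<Rightarrow> ('m, 'n) chart set" where
  "charts_at M p = {c \<in> atlas M. p \<in> chart_dom c}"

definition tangent_space :: "('m, 'n::finite) riemannian \<Rightarrow> 'm \<Rightarrow> ('m, 'n) tvec set" where
  "tangent_space M p = {v. (\<forall>c. c \<notin> charts_at M p \<longrightarrow> v c = 0) \<and>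
     (\<forall>c\<in>charts_at M p. \<forall>c'\<in>charts_at M p.
        v c' = frechet_derivative (transition c c') (at (chart_map c p)) (v c))}"

definition tzero :: "('m, 'n::finite) tvec" where
  "tzero = (\<lambda>c. 0)"

definition tadd :: "('m, 'n::finite) tvec \<Rightarrow> ('m, 'n) tvec \<Rightarrow> ('m, 'n) tvec" where
  "tadd u v = (\<lambda>c. u c + v c)"

definition tscale :: "real \<Rightarrow> ('m, 'n::finite) tvec \<Rightarrow> ('m, 'n) tvec" where
  "tscale r v = (\<lambda>c. r *\<^sub>R v c)"

definition tangent_of_coords ::
    "('m, 'n::finite) riemannian \<Rightarrow> ('m, 'n) chart \<Rightarrow> 'm \<Rightarrow> real^'n \<Rightarrow> ('m, 'n) tvec" where
  "tangent_of_coords M c p a = (\<lambda>c'. if c' \<in> charts_at M p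
     then frechet_derivative (transition c c') (at (chart_map c p)) a else 0)"

text \<open>The Gram matrix \<open>(g\<^sub>i\<^sub>j)\<close> of the coordinate frame, as a function of the coordinates.\<close>

definition gram :: "('m, 'n::finite) riemannian \<Rightarrow> ('m, 'n) chart \<Rightarrow> real^'n \<Rightarrow> real^'n^'n" where
  "gram M c x = (\<chi> i j. metric_at M (chart_inv c x)
     (tangent_of_coords M c (chart_inv c x) (axis i 1))
     (tangent_of_coords M c (chart_inv c x) (axis j 1)))"

definition riemannian_metric :: "('m, 'n::finite) riemannian \<Rightarrow> bool" where
  "riemannian_metric M \<longleftrightarrow>
     (\<forall>p. \<forall>u\<in>tangent_space M p. \<forall>v\<in>tangent_space M p.
        metric_at M p u v = metric_at M p v u \<and>
        (u \<noteq> tzero \<longrightarrow> metric_at M p u u > 0) \<and>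
        (\<forall>r. metric_at M p (tscale r u) v = r * metric_at M p u v) \<and>
        (\<forall>w\<in>tangent_space M p.
           metric_at M p (tadd u w) v = metric_at M p u v + metric_at M p w v)) \<and>
     (\<forall>c\<in>atlas M. smooth_on (chart_map c ` chart_dom c) (gram M c))"

definition riemannian_manifold ::
    "('m::{t2_space, second_countable_topology}, 'n::finite) riemannian \<Rightarrow> bool" where
  "riemannian_manifold M \<longleftrightarrow> smooth_atlas (atlas M) \<and> riemannian_metric M"

definition tnorm :: "('m, 'n::finite) riemannian \<Rightarrow> 'm \<Rightarrow> ('m, 'n) tvec \<Rightarrow> real" where
  "tnorm M p v = sqrt (metric_at M p v v)"

section \<open>Riemannian distance\<close>

definition velocity ::
    "('m, 'n::finite) riemannian \<Rightarrow> (real \<Rightarrow> 'm) \<Rightarrow> real \<Rightarrow> ('m, 'n) tvec" where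
  "velocity M \<gamma> t = (\<lambda>c. if c \<in> charts_at M (\<gamma> t)
     then vector_derivative (chart_map c \<circ> \<gamma>) (at t) else 0)"

definition C1_curve_on ::
    "('m::topological_space, 'n::finite) riemannian \<Rightarrow> real \<Rightarrow> real \<Rightarrow> (real \<Rightarrow> 'm) \<Rightarrow> bool" where
  "C1_curve_on M a b \<gamma> \<longleftrightarrow> continuous_on {a..b} \<gamma> \<and>
     (\<forall>c\<in>atlas M. \<exists>D. continuous_on {t\<in>{a..b}. \<gamma> t \<in> chart_dom c} D \<and>
        (\<forall>t\<in>{a..b}. \<gamma> t \<in> chart_dom c \<longrightarrow>
           ((chart_map c \<circ> \<gamma>) has_vector_derivative D t) (at t within {a..b})))"

text \<open>Here \<open>S\<close> is the set of points of a subdivision of \<open>[0,1]\<close>.\<close>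

definition piecewise_C1_curve ::
    "('m::topological_space, 'n::finite) riemannian \<Rightarrow> (real \<Rightarrow> 'm) \<Rightarrow> bool" where
  "piecewise_C1_curve M \<gamma> \<longleftrightarrow> (\<exists>S. finite S \<and> {0, 1} \<subseteq> S \<and> S \<subseteq> {0..1} \<and>
     (\<forall>a\<in>S. \<forall>b\<in>S. a < b \<and> {a<..<b} \<inter> S = {} \<longrightarrow> C1_curve_on M a b \<gamma>))"

definition curve_length ::
    "('m, 'n::finite) riemannian \<Rightarrow> (real \<Rightarrow> 'm) \<Rightarrow> real" where
  "curve_length M \<gamma> = integral {0..1} (\<lambda>t. tnorm M (\<gamma> t) (velocity M \<gamma> t))"

definition rdist :: "('m::topological_space, 'n::finite) riemannian \<Rightarrow> 'm \<Rightarrow> 'm \<Rightarrow> real" where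
  "rdist M p q = Inf {curve_length M \<gamma> | \<gamma>. piecewise_C1_curve M \<gamma> \<and> \<gamma> 0 = p \<and> \<gamma> 1 = q}"

section \<open>Levi-Civita connection, geodesics and curvature\<close>

definition partial_deriv :: "'n::finite \<Rightarrow> (real^'n \<Rightarrow> real) \<Rightarrow> real^'n \<Rightarrow> real" where
  "partial_deriv i h x = frechet_derivative h (at x) (axis i 1)"

definition christoffel ::
    "('m, 'n::finite) riemannian \<Rightarrow> ('m, 'n) chart \<Rightarrow> 'n \<Rightarrow> 'n \<Rightarrow> 'n \<Rightarrow> real^'n \<Rightarrow> real" where
  "christoffel M c k i j x = (\<Sum>l\<in>UNIV. matrix_inv (gram M c x) $ k $ l *
     (partial_deriv i (\<lambda>y. gram M c y $ j $ l) x
      + partial_deriv j (\<lambda>y. gram M c y $ i $ l) x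
      - partial_deriv l (\<lambda>y. gram M c y $ i $ j) x)) / 2"

definition geodesic ::
    "('m::topological_space, 'n::finite) riemannian \<Rightarrow> (real \<Rightarrow> 'm) \<Rightarrow> bool" where
  "geodesic M \<gamma> \<longleftrightarrow> continuous_on UNIV \<gamma> \<and>
     (\<forall>c\<in>atlas M. \<forall>t. \<gamma> t \<in> chart_dom c \<longrightarrow>
        (let x = chart_map c \<circ> \<gamma>; x' = (\<lambda>s. vector_derivative x (at s)) in
           x differentiable (at t) \<and>
           (x' has_vector_derivative
              (\<chi> k. - (\<Sum>i\<in>UNIV. \<Sum>j\<in>UNIV. christoffel M c k i j (x t) * x' t $ i * x' t $ j)))
             (at t)))"

text \<open>
  The number \<open>curvature_coeff M c l i j k x\<close> is the \<open>l\<close>-th component of \<open>R(\<partial>\<^sub>i,\<partial>\<^sub>j)\<partial>\<^sub>k\<close>, with the sign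
  convention \<open>R(X,Y)Z = \<nabla>\<^sub>X\<nabla>\<^sub>YZ - \<nabla>\<^sub>Y\<nabla>\<^sub>XZ - \<nabla>\<^bsub>[X,Y]\<^esub>Z\<close>.
\<close>

definition curvature_coeff ::
    "('m, 'n::finite) riemannian \<Rightarrow> ('m, 'n) chart \<Rightarrow> 'n \<Rightarrow> 'n \<Rightarrow> 'n \<Rightarrow> 'n \<Rightarrow> real^'n \<Rightarrow> real" where
  "curvature_coeff M c l i j k x =
     partial_deriv i (christoffel M c l j k) x - partial_deriv j (christoffel M c l i k) x
     + (\<Sum>m\<in>UNIV. christoffel M c m j k x * christoffel M c l i m x
                  - christoffel M c m i k x * christoffel M c l j m x)"

definition riemann_curvature ::
    "('m, 'n::finite) riemannian \<Rightarrow> ('m, 'n) chart \<Rightarrow> 'm \<Rightarrow>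
     ('m, 'n) tvec \<Rightarrow> ('m, 'n) tvec \<Rightarrow> ('m, 'n) tvec \<Rightarrow> ('m, 'n) tvec" where
  "riemann_curvature M c p u v w = tangent_of_coords M c p
     (\<chi> l. \<Sum>i\<in>UNIV. \<Sum>j\<in>UNIV. \<Sum>k\<in>UNIV.
        curvature_coeff M c l i j k (chart_map c p) * u c $ i * v c $ j * w c $ k)"

text \<open>The value does not depend on the chart \<open>c\<close> around \<open>p\<close> used for the computation.\<close>

definition sectional_curvature ::
    "('m, 'n::finite) riemannian \<Rightarrow> ('m, 'n) chart \<Rightarrow> 'm \<Rightarrow>
     ('m, 'n) tvec \<Rightarrow> ('m, 'n) tvec \<Rightarrow> real" where
  "sectional_curvature M c p u v = metric_at M p (riemann_curvature M c p u v v) u /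
     (metric_at M p u u * metric_at M p v v - (metric_at M p u v)\<^sup>2)"

definition nonpositive_curvature :: "('m, 'n::finite) riemannian \<Rightarrow> bool" where
  "nonpositive_curvature M \<longleftrightarrow>
     (\<forall>p. \<forall>c\<in>charts_at M p. \<forall>u\<in>tangent_space M p. \<forall>v\<in>tangent_space M p.
        (\<forall>a b. tadd (tscale a u) (tscale b v) = tzero \<longrightarrow> a = 0 \<and> b = 0) \<longrightarrow>
        sectional_curvature M c p u v \<le> 0)"

definition geodesically_complete ::
    "('m::topological_space, 'n::finite) riemannian \<Rightarrow> bool" where
  "geodesically_complete M \<longleftrightarrow>
     (\<forall>p. \<forall>v\<in>tangent_space M p. \<exists>\<gamma>. geodesic M \<gamma> \<and> \<gamma> 0 = p \<and> velocity M \<gamma> 0 = v)"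

text \<open>Connectedness is part of the library's notion of simple connectedness.\<close>

definition hadamard_manifold ::
    "('m::{t2_space, second_countable_topology}, 'n::finite) riemannian \<Rightarrow> bool" where
  "hadamard_manifold M \<longleftrightarrow> riemannian_manifold M \<and> geodesically_complete M \<and>
     simply_connected (UNIV :: 'm set) \<and> nonpositive_curvature M"

definition exp_map ::
    "('m::topological_space, 'n::finite) riemannian \<Rightarrow> 'm \<Rightarrow> ('m, 'n) tvec \<Rightarrow> 'm" where
  "exp_map M p v = (THE \<gamma>. geodesic M \<gamma> \<and> \<gamma> 0 = p \<and> velocity M \<gamma> 0 = v) 1"

definition exp_inv ::
    "('m::topological_space, 'n::finite) riemannian \<Rightarrow> 'm \<Rightarrow> 'm \<Rightarrow> ('m, 'n) tvec" where
  "exp_inv M p = inv_into (tangent_space M p) (exp_map M p)"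

section \<open>Busemann functions and conjugation\<close>

definition ray ::
    "('m::topological_space, 'n::finite) riemannian \<Rightarrow> 'm \<Rightarrow> ('m, 'n) tvec \<Rightarrow> real \<Rightarrow> 'm" where
  "ray M q u t = exp_map M q (tscale t u)"

definition normalize_at ::
    "('m, 'n::finite) riemannian \<Rightarrow> 'm \<Rightarrow> ('m, 'n) tvec \<Rightarrow> ('m, 'n) tvec" where
  "normalize_at M q u = tscale (1 / tnorm M q u) u"

definition busemann ::
    "('m::topological_space, 'n::finite) riemannian \<Rightarrow> 'm \<Rightarrow> ('m, 'n) tvec \<Rightarrow> 'm \<Rightarrow> real" where
  "busemann M q u x = Lim at_top (\<lambda>t. rdist M x (ray M q (normalize_at M q u) t) - t)"

definition asymptotic ::
    "('m::topological_space, 'n::finite) riemannian \<Rightarrow> (real \<Rightarrow> 'm) \<Rightarrow> (real \<Rightarrow> 'm) \<Rightarrow> bool" where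
  "asymptotic M \<gamma> \<sigma> \<longleftrightarrow> bounded ((\<lambda>t. rdist M (\<gamma> t) (\<sigma> t)) ` {0..})"

definition busemann_coupling ::
    "('m::topological_space, 'n::finite) riemannian \<Rightarrow> 'm \<Rightarrow> 'm \<Rightarrow> 'm \<Rightarrow> real" where
  "busemann_coupling M p z y =
     (if z = p then 0 else rdist M p z * busemann M p (tscale (- 1) (exp_inv M p z)) y)"

definition proper_fun :: "('m \<Rightarrow> ereal) \<Rightarrow> bool" where
  "proper_fun f \<longleftrightarrow> (\<forall>x. f x \<noteq> - \<infinity>) \<and> (\<exists>x. f x < \<infinity>)"

definition conjugate ::
    "('m::topological_space, 'n::finite) riemannian \<Rightarrow> 'm \<Rightarrow> ('m \<Rightarrow> ereal) \<Rightarrow> 'm \<Rightarrow> ereal" where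
  "conjugate M p f y = (SUP z. ereal (busemann_coupling M p z y) - f z)"

definition biconjugate ::
    "('m::topological_space, 'n::finite) riemannian \<Rightarrow> 'm \<Rightarrow> ('m \<Rightarrow> ereal) \<Rightarrow> 'm \<Rightarrow> ereal" where
  "biconjugate M p f x = (SUP y. ereal (busemann_coupling M p y x) - conjugate M p f y)"

definition nonlinearity ::
    "('m::topological_space, 'n::finite) riemannian \<Rightarrow> 'm \<Rightarrow> 'm \<Rightarrow> ereal" where
  "nonlinearity M p y =
     (INF z. ereal (busemann_coupling M p y z - busemann_coupling M p z y))"

definition asymptotic_dir ::
    "('m::topological_space, 'n::finite) riemannian \<Rightarrow> 'm \<Rightarrow> 'm \<Rightarrow> ('m, 'n) tvec \<Rightarrow> ('m, 'n) tvec"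
  where
  "asymptotic_dir M p x v = (THE u. u \<in> tangent_space M p \<and> tnorm M p u = 1 \<and>
     asymptotic M (ray M p u) (ray M x (tscale (- 1) (normalize_at M x v))))"

definition dual_point ::
    "('m::topological_space, 'n::finite) riemannian \<Rightarrow> 'm \<Rightarrow> 'm \<Rightarrow> ('m, 'n) tvec \<Rightarrow> 'm" where
  "dual_point M p x v = (if v = tzero then p
     else exp_map M p (tscale (- tnorm M x v) (asymptotic_dir M p x v)))"

definition subdifferential ::
    "('m::topological_space, 'n::finite) riemannian \<Rightarrow> 'm \<Rightarrow> ('m \<Rightarrow> ereal) \<Rightarrow> 'm \<Rightarrow> ('m, 'n) tvec set"
  where
  "subdifferential M p f x = {v \<in> tangent_space M x. \<forall>z.
     f z \<ge> f x + ereal (busemann_coupling M p z (dual_point M p x v))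
           - ereal (busemann_coupling M p x (dual_point M p x v))}"

definition dual_points ::
    "('m::topological_space, 'n::finite) riemannian \<Rightarrow> 'm \<Rightarrow> ('m \<Rightarrow> ereal) \<Rightarrow> 'm \<Rightarrow> 'm set" where
  "dual_points M p f x = dual_point M p x ` subdifferential M p f x"

end

(* Taking z = x in the supremum defining the conjugate gives the lower bound for the duality gap
   f x - f** x. At a dual point y that supremum is attained at z = x, so the term of the
   biconjugate at y bounds the gap from above. *)
theory Submission
  imports Defs
begin

lemma conjugate_ge:
  "conjugate M p f y \<ge> ereal (busemann_coupling M p x y) - f x"
  unfolding conjugate_def by (rule SUP_upper) simp

text \<open>Rearranged, the subgradient inequality bounds every term of the supremum by its term at
  x, so that term is the maximum.\<close>

lemma conjugate_at_dual_point:
  assumes "f x \<noteq> \<infinity>" and "f x \<noteq> - \<infinity>" and "y \<in> dual_points M p f x"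
  shows "conjugate M p f y = ereal (busemann_coupling M p x y) - f x"
proof (rule antisym)
  show "conjugate M p f y \<le> ereal (busemann_coupling M p x y) - f x"
    unfolding conjugate_def
  proof (rule SUP_least)
    fix z
    have "f z \<ge> f x + ereal (busemann_coupling M p z y) - ereal (busemann_coupling M p x y)"
      using assms(3) by (auto simp: dual_points_def subdifferential_def)
    \<comment> \<open>If \<open>f z\<close> is \<infinity>, the left side is -\<infinity>; the value
      -\<infinity> is ruled out by the subgradient inequality, as \<open>f x\<close> is
      finite.\<close>
    then show "ereal (busemann_coupling M p z y) - f z \<le> ereal (busemann_coupling M p x y) - f x"
      using assms(1,2) by (cases "f x"; cases "f z") auto
  qed
qed (rule conjugate_ge)

lemma nonlinearity_le:
  "nonlinearity M p y \<le> ereal (busemann_coupling M p y z - busemann_coupling M p z y)"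
  unfolding nonlinearity_def by (rule INF_lower) simp

text \<open>With H for \<open>busemann_coupling M p\<close>, each term of the biconjugate is at most
  H y x - H x y + f x, and H y x - H x y never exceeds minus the nonlinearity at x.\<close>

lemma nonlinearity_le_duality_gap:
  assumes "f x \<noteq> \<infinity>" and "f x \<noteq> - \<infinity>"
  shows "nonlinearity M p x \<le> f x - biconjugate M p f x"
proof -
  have "biconjugate M p f x \<le> f x - nonlinearity M p x"
    unfolding biconjugate_def
  proof (rule SUP_least)
    fix y
    \<comment> \<open>An infinite conjugate makes the left side -\<infinity>; a nonlinearity of
      -\<infinity> makes the right side \<infinity>.\<close>
    show "ereal (busemann_coupling M p y x) - conjugate M p f y \<le> f x - nonlinearity M p x"
      using conjugate_ge[of M p x y f] nonlinearity_le[of M p x y] assms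
      by (cases "f x"; cases "conjugate M p f y"; cases "nonlinearity M p x") auto
  qed
  then show ?thesis
    using assms
    by (cases "f x"; cases "biconjugate M p f x"; cases "nonlinearity M p x") auto
qed

lemma duality_gap_le:
  assumes "f x \<noteq> \<infinity>" and "f x \<noteq> - \<infinity>" and "y \<in> dual_points M p f x"
  shows "f x - biconjugate M p f x
    \<le> ereal (busemann_coupling M p x y - busemann_coupling M p y x)"
proof -
  have "ereal (busemann_coupling M p y x) - conjugate M p f y \<le> biconjugate M p f x"
    unfolding biconjugate_def by (rule SUP_upper) simp
  then show ?thesis
    unfolding conjugate_at_dual_point[OF assms] using assms(1,2)
    by (cases "f x"; cases "biconjugate M p f x") auto
qed

text \<open>The infimum at y is tested with z = x; negation swaps the two couplings.\<close>

lemma coupling_diff_le_uminus_nonlinearity: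
  "ereal (busemann_coupling M p x y - busemann_coupling M p y x) \<le> - nonlinearity M p y"
  using nonlinearity_le[of M p y x] by (cases "nonlinearity M p y") auto

theorem theorem26:
  fixes M :: "('m::{t2_space, second_countable_topology}, 'n::finite) riemannian"
    and p x :: 'm and f :: "'m \<Rightarrow> ereal"
  assumes "hadamard_manifold M"
    and "proper_fun f"
    and "f x < \<infinity>"
  shows "nonlinearity M p x \<le> f x - biconjugate M p f x \<and>
    (subdifferential M p f x \<noteq> {} \<longrightarrow>
      (\<forall>y\<in>dual_points M p f x.
         nonlinearity M p x \<le> f x - biconjugate M p f x \<and>
         f x - biconjugate M p f x
           \<le> ereal (busemann_coupling M p x y - busemann_coupling M p y x) \<and>
         ereal (busemann_coupling M p x y - busemann_coupling M p y x)
           \<le> - nonlinearity M p y)) \<and>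
    f x - biconjugate M p f x \<le> (INF y\<in>dual_points M p f x. - nonlinearity M p y)"
proof -
  have "f x \<noteq> \<infinity>" and "f x \<noteq> - \<infinity>"
    using assms by (auto simp: proper_fun_def)
  note gap_ge = nonlinearity_le_duality_gap[where f = f, OF this]
    and gap_le = duality_gap_le[where f = f, OF this]
  \<comment> \<open>Without dual points the infimum is \<infinity>, in agreement with the convention
    for the empty set.\<close>
  have "f x - biconjugate M p f x \<le> (INF y\<in>dual_points M p f x. - nonlinearity M p y)"
    by (blast intro: INF_greatest order_trans gap_le coupling_diff_le_uminus_nonlinearity)
  then show ?thesis
    by (blast intro: gap_ge gap_le coupling_diff_le_uminus_nonlinearity)
qed

end
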